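(* (i) Let $R$ be a congruence-simple hemiring. Then $R$ is a $J$-radical hemiring (i.e. $J(R)=R$) or a primitive hemiring. (ii) A $J$-semisimple hemiring $R$ (i.e. a hemiring with $J(R)=0$) is congruence-simple if and only if $R$ is a simple ring.
   Context: A hemiring $(R,+,\cdot,0)$ consists of a commutative monoid $(R,+,0)$ and a semigroup $(R,\cdot)$ such that multiplication distributes over addition on both sides and $0r=0=r0$ for all $r$. A hemiring $R$ is congruence-simple if the diagonal and $R^2$ are its only congruences. A simple ring is a ring (a hemiring whose additive monoid is a group; no identity element is required) whose only two-sided ideals are $0$ and itself. A left $R$-semimodule is a commutative monoid $(M,+,0_M)$ with a scalar multiplication $R\times M\to M$ satisfying $(rr')m=r(r'm)$, $r(m+m')=rm+rm'$, $(r+r')m=rm+r'm$, $r0_M=0_M=0m$. It is cancellative if $x+z=y+z$ implies $x=y$, and faithful if $(0:M)_R:=\{r\in R\mid rM=0\}=0$. A nonzero cancellative left $R$-semimodule $M$ is irreducible if for every pair $m_1\neq m_2$ in $M$ and every $m\in M$ there are $r_1,r_2\in R$ with $m+r_1m_1+r_2m_2=r_1m_2+r_2m_1$. A hemiring is primitive if it has a faithful irreducible left semimodule. Jacobson(-Bourne) radical: a right ideal $I$ of $R$ is right semiregular if for all $i_1,i_2\in I$ there are $j_1,j_2\in I$ with $i_1+j_1+i_1j_1+i_2j_2=i_2+j_2+i_1j_2+i_2j_1$; $J(R)$ is the sum of all right semiregular right ideals of $R$. It is a two-sided ideal, and it is known that $J(R)=\bigcap(0:M)_R$ over all irreducible left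 $R$-semimodules $M$ (with $J(R)=R$ if there are none). *)

theory Defs
  imports "HOL-Algebra.Module"
begin

text \<open>
  Hemirings are the types of class \<^class>\<open>semiring_0\<close>, which has exactly the hemiring axioms.
  Properties of a hemiring as a whole take a type argument.
\<close>

section \<open>Congruences, ideals and the Jacobson radical\<close>

definition hemiring_congruence :: "'r::semiring_0 rel \<Rightarrow> bool" where
  "hemiring_congruence E \<longleftrightarrow> equiv UNIV E \<and>
     (\<forall>a b c d. (a, b) \<in> E \<longrightarrow> (c, d) \<in> E \<longrightarrow> (a + c, b + d) \<in> E \<and> (a * c, b * d) \<in> E)"

definition congruence_simple :: "'r::semiring_0 itself \<Rightarrow> bool" where
  "congruence_simple _ \<longleftrightarrow> (\<forall>E :: 'r rel. hemiring_congruence E \<longrightarrow> E = Id \<or> E = UNIV)"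

definition right_ideal :: "'r::semiring_0 set \<Rightarrow> bool" where
  "right_ideal I \<longleftrightarrow> 0 \<in> I \<and> (\<forall>x\<in>I. \<forall>y\<in>I. x + y \<in> I) \<and> (\<forall>x\<in>I. \<forall>r. x * r \<in> I)"

definition right_semiregular :: "'r::semiring_0 set \<Rightarrow> bool" where
  "right_semiregular I \<longleftrightarrow> (\<forall>i1\<in>I. \<forall>i2\<in>I. \<exists>j1\<in>I. \<exists>j2\<in>I.
     i1 + j1 + i1 * j1 + i2 * j2 = i2 + j2 + i1 * j2 + i2 * j1)"

text \<open>The sum of a family of right ideals consists of the finite sums of elements of its members.\<close>

definition jacobson_radical :: "'r::semiring_0 set" where
  "jacobson_radical = {sum_list xs | xs. set xs \<subseteq> \<Union>{I. right_ideal I \<and> right_semiregular I}}"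

text \<open>
  Ideals of a ring are additive subgroups.  Without an identity element, closure under additive
  inverses does not follow from closure under multiplication and has to be required.
\<close>

definition two_sided_ring_ideal :: "'r::semiring_0 set \<Rightarrow> bool" where
  "two_sided_ring_ideal I \<longleftrightarrow> 0 \<in> I \<and> (\<forall>x\<in>I. \<forall>y\<in>I. x + y \<in> I) \<and>
     (\<forall>x\<in>I. \<forall>y. x + y = 0 \<longrightarrow> y \<in> I) \<and> (\<forall>x\<in>I. \<forall>r. r * x \<in> I \<and> x * r \<in> I)"

definition simple_ring :: "'r::semiring_0 itself \<Rightarrow> bool" where
  "simple_ring _ \<longleftrightarrow> (\<forall>a :: 'r. \<exists>b. a + b = 0) \<and>
     (\<forall>I :: 'r set. two_sided_ring_ideal I \<longrightarrow> I = {0} \<or> I = UNIV)"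

section \<open>Semimodules\<close>

text \<open>
  The \<open>mult\<close> and \<open>one\<close> fields that the record type inherits from rings play no role.
\<close>

locale left_semimodule = abelian_monoid M
  for M :: "('r::semiring_0, 'm) module" (structure) +
  assumes smult_closed: "m \<in> carrier M \<Longrightarrow> r \<odot> m \<in> carrier M"
    and smult_assoc: "m \<in> carrier M \<Longrightarrow> (r * r') \<odot> m = r \<odot> (r' \<odot> m)"
    and smult_add_right: "m \<in> carrier M \<Longrightarrow> m' \<in> carrier M \<Longrightarrow>
      r \<odot> (m \<oplus> m') = r \<odot> m \<oplus> r \<odot> m'"
    and smult_add_left: "m \<in> carrier M \<Longrightarrow> (r + r') \<odot> m = r \<odot> m \<oplus> r' \<odot> m"
    and smult_zero_right: "r \<odot> \<zero> = \<zero>"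
    and smult_zero_left: "m \<in> carrier M \<Longrightarrow> 0 \<odot> m = \<zero>"

definition cancellative :: "('r, 'm) module \<Rightarrow> bool" where
  "cancellative M \<longleftrightarrow> (\<forall>x\<in>carrier M. \<forall>y\<in>carrier M. \<forall>z\<in>carrier M.
     x \<oplus>\<^bsub>M\<^esub> z = y \<oplus>\<^bsub>M\<^esub> z \<longrightarrow> x = y)"

definition annihilator :: "('r, 'm) module \<Rightarrow> 'r set" where
  "annihilator M = {r. \<forall>m\<in>carrier M. r \<odot>\<^bsub>M\<^esub> m = \<zero>\<^bsub>M\<^esub>}"

definition faithful :: "('r::semiring_0, 'm) module \<Rightarrow> bool" where
  "faithful M \<longleftrightarrow> annihilator M = {0}"

definition irreducible_semimodule :: "('r::semiring_0, 'm) module \<Rightarrow> bool" where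
  "irreducible_semimodule M \<longleftrightarrow>
     left_semimodule M \<and> cancellative M \<and> carrier M \<noteq> {\<zero>\<^bsub>M\<^esub>} \<and>
     (\<forall>m1\<in>carrier M. \<forall>m2\<in>carrier M. m1 \<noteq> m2 \<longrightarrow> (\<forall>m\<in>carrier M. \<exists>r1 r2.
        m \<oplus>\<^bsub>M\<^esub> r1 \<odot>\<^bsub>M\<^esub> m1 \<oplus>\<^bsub>M\<^esub> r2 \<odot>\<^bsub>M\<^esub> m2 = r1 \<odot>\<^bsub>M\<^esub> m2 \<oplus>\<^bsub>M\<^esub> r2 \<odot>\<^bsub>M\<^esub> m1))"

text \<open>
  One cannot quantify over the type of the semimodule here.  Carriers inside \<^typ>\<open>'r \<times> 'r\<close> suffice:
  if \<open>a\<close> is a nonzero element of an irreducible semimodule, every \<open>m\<close> satisfies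
  \<open>m + r1 a = r2 a\<close> for some \<open>(r1, r2)\<close>, and \<open>(r1, r2)\<close> determines \<open>m\<close> by cancellation.  The lemma
  \<open>primitive_hemiringI\<close> below shows that semimodules on arbitrary types are covered.
\<close>

definition primitive_hemiring :: "'r::semiring_0 itself \<Rightarrow> bool" where
  "primitive_hemiring _ \<longleftrightarrow>
     (\<exists>M :: ('r, 'r \<times> 'r) module. irreducible_semimodule M \<and> faithful M)"

lemma irreducible_semimodule_embeds:
  fixes M :: "('r::semiring_0, 'm) module"
  assumes "irreducible_semimodule M"
  shows "\<exists>f :: 'm \<Rightarrow> 'r \<times> 'r. inj_on f (carrier M)"
proof -
  interpret left_semimodule M
    using assms by (simp add: irreducible_semimodule_def)
  obtain a where a: "a \<in> carrier M" "a \<noteq> \<zero>\<^bsub>M\<^esub>"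
    using assms zero_closed unfolding irreducible_semimodule_def by blast
  have "\<exists>p. m \<oplus>\<^bsub>M\<^esub> fst p \<odot>\<^bsub>M\<^esub> a = snd p \<odot>\<^bsub>M\<^esub> a" if m: "m \<in> carrier M" for m
  proof -
    obtain r1 r2 where
      "m \<oplus>\<^bsub>M\<^esub> r1 \<odot>\<^bsub>M\<^esub> a \<oplus>\<^bsub>M\<^esub> r2 \<odot>\<^bsub>M\<^esub> \<zero>\<^bsub>M\<^esub> = r1 \<odot>\<^bsub>M\<^esub> \<zero>\<^bsub>M\<^esub> \<oplus>\<^bsub>M\<^esub> r2 \<odot>\<^bsub>M\<^esub> a"
      using assms a m zero_closed unfolding irreducible_semimodule_def by blast
    then have "m \<oplus>\<^bsub>M\<^esub> r1 \<odot>\<^bsub>M\<^esub> a = r2 \<odot>\<^bsub>M\<^esub> a"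
      using a m by (simp add: smult_zero_right smult_closed)
    then show ?thesis by (intro exI[of _ "(r1, r2)"]) simp
  qed
  then obtain f where f: "\<And>m. m \<in> carrier M \<Longrightarrow>
      m \<oplus>\<^bsub>M\<^esub> fst (f m) \<odot>\<^bsub>M\<^esub> a = snd (f m) \<odot>\<^bsub>M\<^esub> a"
    by metis
  have "inj_on f (carrier M)"
  proof (rule inj_onI)
    fix x y assume xy: "x \<in> carrier M" "y \<in> carrier M" "f x = f y"
    then have "x \<oplus>\<^bsub>M\<^esub> fst (f x) \<odot>\<^bsub>M\<^esub> a = y \<oplus>\<^bsub>M\<^esub> fst (f x) \<odot>\<^bsub>M\<^esub> a"
      using f by metis
    then show "x = y"
      using assms xy a smult_closed unfolding irreducible_semimodule_def cancellative_def by blast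
  qed
  then show ?thesis by blast
qed

lemma primitive_hemiringI:
  fixes M :: "('r::semiring_0, 'm) module"
  assumes irr: "irreducible_semimodule M" and "faithful M"
  shows "primitive_hemiring TYPE('r)"
proof -
  interpret left_semimodule M
    using irr by (simp add: irreducible_semimodule_def)
  obtain f :: "'m \<Rightarrow> 'r \<times> 'r" where f: "inj_on f (carrier M)"
    using irreducible_semimodule_embeds[OF irr] by blast
  define g where "g = inv_into (carrier M) f"
  have g [simp]: "g (f x) = x" if "x \<in> carrier M" for x
    using f that by (simp add: g_def)
  have f_eq [simp]: "f x = f y \<longleftrightarrow> x = y" if "x \<in> carrier M" "y \<in> carrier M" for x y
    using f that by (simp add: inj_on_eq_iff)
  define N :: "('r, 'r \<times> 'r) module" where
    "N = \<lparr>carrier = f ` carrier M, mult = undefined, one = undefined, zero = f \<zero>\<^bsub>M\<^esub>,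
       add = (\<lambda>x y. f (g x \<oplus>\<^bsub>M\<^esub> g y)), smult = (\<lambda>r x. f (r \<odot>\<^bsub>M\<^esub> g x))\<rparr>"
  have N [simp]: "carrier N = f ` carrier M" "\<zero>\<^bsub>N\<^esub> = f \<zero>\<^bsub>M\<^esub>"
    "\<And>x y. x \<oplus>\<^bsub>N\<^esub> y = f (g x \<oplus>\<^bsub>M\<^esub> g y)" "\<And>r x. r \<odot>\<^bsub>N\<^esub> x = f (r \<odot>\<^bsub>M\<^esub> g x)"
    by (simp_all add: N_def)
  have "abelian_monoid N"
  proof (rule abelian_monoidI)
    fix x y assume "x \<in> carrier N" "y \<in> carrier N"
    then show "x \<oplus>\<^bsub>N\<^esub> y = y \<oplus>\<^bsub>N\<^esub> x" by (auto simp: a_comm)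
  qed (auto simp: a_assoc)
  then have "left_semimodule N"
    by (rule left_semimodule.intro, intro left_semimodule_axioms.intro)
      (auto simp: smult_closed smult_assoc smult_add_right smult_add_left smult_zero_right
        smult_zero_left)
  moreover have "cancellative N"
    using irr by (auto simp: irreducible_semimodule_def cancellative_def)
  moreover have "carrier N \<noteq> {\<zero>\<^bsub>N\<^esub>}"
  proof
    assume "carrier N = {\<zero>\<^bsub>N\<^esub>}"
    then have "f ` carrier M = f ` {\<zero>\<^bsub>M\<^esub>}" by simp
    then have "carrier M = {\<zero>\<^bsub>M\<^esub>}"
      using f by (subst (asm) inj_on_image_eq_iff) auto
    then show False using irr by (simp add: irreducible_semimodule_def)
  qed
  moreover have "\<exists>r1 r2. m \<oplus>\<^bsub>N\<^esub> r1 \<odot>\<^bsub>N\<^esub> m1 \<oplus>\<^bsub>N\<^esub> r2 \<odot>\<^bsub>N\<^esub> m2 = r1 \<odot>\<^bsub>N\<^esub> m2 \<oplus>\<^bsub>N\<^esub> r2 \<odot>\<^bsub>N\<^esub> m1"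
    if mm: "m1 \<in> carrier N" "m2 \<in> carrier N" "m \<in> carrier N" "m1 \<noteq> m2" for m m1 m2
  proof -
    obtain n1 n2 n where n: "n1 \<in> carrier M" "n2 \<in> carrier M" "n \<in> carrier M"
      "m1 = f n1" "m2 = f n2" "m = f n"
      using mm by auto
    have "n1 \<noteq> n2" using n \<open>m1 \<noteq> m2\<close> by auto
    then have "\<exists>r1 r2.
      n \<oplus>\<^bsub>M\<^esub> r1 \<odot>\<^bsub>M\<^esub> n1 \<oplus>\<^bsub>M\<^esub> r2 \<odot>\<^bsub>M\<^esub> n2 = r1 \<odot>\<^bsub>M\<^esub> n2 \<oplus>\<^bsub>M\<^esub> r2 \<odot>\<^bsub>M\<^esub> n1"
      using irr n(1-3) by (simp add: irreducible_semimodule_def)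
    then obtain r1 r2 where
      "n \<oplus>\<^bsub>M\<^esub> r1 \<odot>\<^bsub>M\<^esub> n1 \<oplus>\<^bsub>M\<^esub> r2 \<odot>\<^bsub>M\<^esub> n2 = r1 \<odot>\<^bsub>M\<^esub> n2 \<oplus>\<^bsub>M\<^esub> r2 \<odot>\<^bsub>M\<^esub> n1"
      by blast
    then show ?thesis using n by (intro exI[of _ r1] exI[of _ r2]) (simp add: smult_closed)
  qed
  ultimately have "irreducible_semimodule N"
    unfolding irreducible_semimodule_def by blast
  moreover have "annihilator N = annihilator M"
    by (auto simp: annihilator_def smult_closed)
  ultimately show ?thesis
    using \<open>faithful M\<close> unfolding primitive_hemiring_def faithful_def by metis
qed

end

theory Submission imports Defs begin

text \<open>
  The crux is that a congruence-simple hemiring \<open>R\<close> is either \<open>J\<close>-radical or a ring, because two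
  congruences must be trivial.  The first identifies \<open>x\<close> and \<open>y\<close> when \<open>x + z = y + z\<close> for some
  \<open>z\<close>.  If it is total, then such a \<open>z\<close> solves the equation of semiregularity for the pair
  \<open>(x, y)\<close>, so that \<open>J(R) = R\<close>; otherwise \<open>R\<close> is cancellative.  The second identifies \<open>x\<close> and
  \<open>y\<close> when each is a summand of a multiple of the other.  It identifies \<open>x\<close> with \<open>x + x\<close>, so in a
  nonzero cancellative \<open>R\<close> it is not the diagonal; hence it is total and identifies every \<open>x\<close> with \<open>0\<close>,
  which says that \<open>x\<close> has an additive inverse.  This is \<open>congruence_simple_radical_or_ring\<close>.

  Since the congruences of a ring correspond to its ideals, a congruence-simple ring is the same as
  a simple ring, which gives the second part.

  For the first part the only case left is a ring that is not right semiregular.  Some element \<open>a\<close>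
  then has no left quasi-inverse: if all had one, left quasi-inverses would be two-sided, by
  the usual argument for monoids applied to \<open>x \<circ> y = x + y + x y\<close>.  The left ideal of all
  \<open>r + r a\<close> omits \<open>a\<close>, and by Zorn's lemma it lies in a left ideal \<open>I\<close> that is maximal among those
  omitting \<open>a\<close>.  The quotient by \<open>I\<close> is irreducible (\<open>exists_irreducible_semimodule\<close>).
  Finally, an irreducible semimodule is faithful over any congruence-simple hemiring, since acting
  equally is a congruence that is not total.
\<close>

section \<open>Congruence-simple hemirings are radical or rings\<close>

lemma equiv_UNIVI:
  assumes "\<And>x. (x, x) \<in> E"
    and "\<And>x y. (x, y) \<in> E \<Longrightarrow> (y, x) \<in> E"
    and "\<And>x y z. (x, y) \<in> E \<Longrightarrow> (y, z) \<in> E \<Longrightarrow> (x, z) \<in> E"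
  shows "equiv UNIV E"
proof (rule equivI)
  show "E \<subseteq> UNIV \<times> UNIV" by simp
  show "refl_on UNIV E" using assms(1) by (simp add: refl_on_def)
  show "sym E" by (rule symI) (rule assms(2))
  show "trans E" by (rule transI) (rule assms(3))
qed

lemma hemiring_congruenceI:
  assumes "\<And>x. (x, x) \<in> E"
    and "\<And>x y. (x, y) \<in> E \<Longrightarrow> (y, x) \<in> E"
    and "\<And>x y z. (x, y) \<in> E \<Longrightarrow> (y, z) \<in> E \<Longrightarrow> (x, z) \<in> E"
    and add: "\<And>x y c. (x, y) \<in> E \<Longrightarrow> (x + c, y + c) \<in> E"
    and mult: "\<And>x y c. (x, y) \<in> E \<Longrightarrow> (x * c, y * c) \<in> E"
      "\<And>x y c. (x, y) \<in> E \<Longrightarrow> (c * x, c * y) \<in> E"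
  shows "hemiring_congruence E"
proof -
  have "equiv UNIV E"
    by (rule equiv_UNIVI) (fact assms)+
  moreover have "(a + c, b + d) \<in> E" if "(a, b) \<in> E" "(c, d) \<in> E" for a b c d
    using assms(3)[OF add[OF that(1), of c] add[OF that(2), of b, unfolded add.commute[of _ b]]]
    by simp
  moreover have "(a * c, b * d) \<in> E" if "(a, b) \<in> E" "(c, d) \<in> E" for a b c d
    using assms(3)[OF mult(1)[OF that(1)] mult(2)[OF that(2)]] .
  ultimately show ?thesis unfolding hemiring_congruence_def by blast
qed

lemma hemiring_congruenceD:
  assumes "hemiring_congruence E"
  shows "(x, x) \<in> E"
    and "(x, y) \<in> E \<Longrightarrow> (y, x) \<in> E"
    and "(x, y) \<in> E \<Longrightarrow> (y, z) \<in> E \<Longrightarrow> (x, z) \<in> E"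
    and "(x, y) \<in> E \<Longrightarrow> (u, v) \<in> E \<Longrightarrow> (x + u, y + v) \<in> E"
    and "(x, y) \<in> E \<Longrightarrow> (u, v) \<in> E \<Longrightarrow> (x * u, y * v) \<in> E"
proof -
  have "refl E" "sym E" "trans E"
    using assms by (simp_all add: hemiring_congruence_def equiv_def)
  then show "(x, x) \<in> E"
    and "(x, y) \<in> E \<Longrightarrow> (y, x) \<in> E"
    and "(x, y) \<in> E \<Longrightarrow> (y, z) \<in> E \<Longrightarrow> (x, z) \<in> E"
    by (simp add: refl_on_def, metis symD, metis transD)
  show "(x, y) \<in> E \<Longrightarrow> (u, v) \<in> E \<Longrightarrow> (x + u, y + v) \<in> E"
    and "(x, y) \<in> E \<Longrightarrow> (u, v) \<in> E \<Longrightarrow> (x * u, y * v) \<in> E"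
    using assms by (simp_all add: hemiring_congruence_def)
qed

definition cancellation_congruence :: "'r::semiring_0 rel" where
  "cancellation_congruence = {(x, y). \<exists>z. x + z = y + z}"

lemma hemiring_congruence_cancellation:
  "hemiring_congruence (cancellation_congruence :: 'r::semiring_0 rel)"
proof (rule hemiring_congruenceI; clarsimp simp: cancellation_congruence_def)
  fix x y z c d :: 'r
  assume "x + c = y + c" "y + d = z + d"
  then have "x + (c + d) = z + (c + d)" by (metis add.assoc add.commute)
  then show "\<exists>c. x + c = z + c" ..
next
  fix x y :: 'r and z
  assume "x + z = y + z"
  then show "\<exists>w. y + w = x + w" by metis
next
  fix x y c z :: 'r
  assume "x + z = y + z"
  then have "x + c + z = y + c + z" by (metis add.assoc add.commute)
  then show "\<exists>z. x + c + z = y + c + z" ..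
next
  fix x y c z :: 'r
  assume "x + z = y + z"
  then show "\<exists>w. x * c + w = y * c + w" by (metis distrib_right)
next
  fix x y c z :: 'r
  assume "x + z = y + z"
  then show "\<exists>w. c * x + w = c * y + w" by (metis distrib_left)
qed

lemma jacobson_radical_UNIV_if_semiregular:
  assumes "right_semiregular (UNIV :: 'r::semiring_0 set)"
  shows "jacobson_radical = (UNIV :: 'r set)"
proof -
  have "right_ideal (UNIV :: 'r set)" by (simp add: right_ideal_def)
  with assms have "\<Union>{I. right_ideal I \<and> right_semiregular I} = (UNIV :: 'r set)" by blast
  moreover have "\<exists>xs. x = sum_list xs" for x :: 'r
    by (rule exI[of _ "[x]"]) simp
  ultimately show ?thesis by (auto simp: jacobson_radical_def)
qed

lemma semiregular_if_cancellation_total: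
  assumes "cancellation_congruence = (UNIV :: 'r::semiring_0 rel)"
  shows "right_semiregular (UNIV :: 'r set)"
  unfolding right_semiregular_def
proof (intro ballI)
  fix x y :: 'r
  have "(x, y) \<in> cancellation_congruence" using assms by simp
  then obtain z where "x + z = y + z" by (auto simp: cancellation_congruence_def)
  then have "x + z + x * z + y * z = y + z + x * z + y * z" by simp
  then show "\<exists>j1\<in>UNIV. \<exists>j2\<in>UNIV.
      x + j1 + x * j1 + y * j2 = y + j2 + x * j2 + y * j1"
    by blast
qed

text \<open>
  This is the set of summands of multiples of \<open>b\<close>.  It is generated inductively so that statements
  about it need not keep track of multiplicities.
\<close>

inductive_set hereditary_submonoid :: "'r::semiring_0 \<Rightarrow> 'r set" for b where
  base: "b \<in> hereditary_submonoid b"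
| zero: "0 \<in> hereditary_submonoid b"
| add: "x \<in> hereditary_submonoid b \<Longrightarrow> y \<in> hereditary_submonoid b \<Longrightarrow>
    x + y \<in> hereditary_submonoid b"
| summand: "x + y \<in> hereditary_submonoid b \<Longrightarrow> x \<in> hereditary_submonoid b"

lemma hereditary_submonoid_trans:
  assumes "x \<in> hereditary_submonoid y" "y \<in> hereditary_submonoid z"
  shows "x \<in> hereditary_submonoid z"
  using assms(1)
  by induction (auto intro: assms(2) hereditary_submonoid.intros)

lemma hereditary_submonoid_add_right:
  assumes "x \<in> hereditary_submonoid y"
  shows "x + c \<in> hereditary_submonoid (y + c)"
proof -
  have "y \<in> hereditary_submonoid (y + c)" "c \<in> hereditary_submonoid (y + c)"
    by (metis hereditary_submonoid.base hereditary_submonoid.summand add.commute)+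
  then show ?thesis
    using assms by (auto intro: hereditary_submonoid.add hereditary_submonoid_trans)
qed

lemma hereditary_submonoid_mult_right:
  assumes "x \<in> hereditary_submonoid y"
  shows "x * c \<in> hereditary_submonoid (y * c)"
  using assms
  by induction (auto simp: distrib_right intro: hereditary_submonoid.intros)

lemma hereditary_submonoid_mult_left:
  assumes "x \<in> hereditary_submonoid y"
  shows "c * x \<in> hereditary_submonoid (c * y)"
  using assms
  by induction (auto simp: distrib_left intro: hereditary_submonoid.intros)

lemma hereditary_submonoid_zero_invertible:
  assumes "x \<in> hereditary_submonoid (0 :: 'r::semiring_0)"
  shows "\<exists>y. x + y = 0"
  using assms
proof induction
  case (add x y)
  then obtain x' y' where "x + x' = 0" "y + y' = 0" by blast
  then have "x + y + (x' + y') = 0" by (metis add.assoc add.commute add_0)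
  then show ?case ..
qed (auto simp: add.assoc)

definition archimedean_congruence :: "'r::semiring_0 rel" where
  "archimedean_congruence =
     {(x, y). x \<in> hereditary_submonoid y \<and> y \<in> hereditary_submonoid x}"

lemma hemiring_congruence_archimedean: "hemiring_congruence archimedean_congruence"
  unfolding archimedean_congruence_def
  by (rule hemiring_congruenceI)
    (auto intro: hereditary_submonoid.base hereditary_submonoid_trans hereditary_submonoid_add_right
      hereditary_submonoid_mult_left hereditary_submonoid_mult_right)

lemma congruence_simple_cancellative_ring:
  assumes simple: "congruence_simple TYPE('r::semiring_0)"
    and cancel: "\<And>x y z :: 'r. x + z = y + z \<Longrightarrow> x = y"
  shows "\<exists>y. (x :: 'r) + y = 0"
proof -
  consider "archimedean_congruence = (Id :: 'r rel)" | "archimedean_congruence = (UNIV :: 'r rel)"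
    using simple hemiring_congruence_archimedean unfolding congruence_simple_def by blast
  then show ?thesis
  proof cases
    case 1
    have "(x, x + x) \<in> archimedean_congruence"
      by (auto simp: archimedean_congruence_def intro: hereditary_submonoid.intros)
    then have "0 + x = x + x" using 1 by simp
    then have "x = 0" using cancel by metis
    then show ?thesis by (intro exI[of _ 0]) simp
  next
    case 2
    then have "(x, 0) \<in> archimedean_congruence" by simp
    then show ?thesis
      using hereditary_submonoid_zero_invertible by (auto simp: archimedean_congruence_def)
  qed
qed

lemma congruence_simple_radical_or_ring:
  assumes "congruence_simple TYPE('r::semiring_0)"
  shows "jacobson_radical = (UNIV :: 'r set) \<or> (\<forall>a :: 'r. \<exists>b. a + b = 0)"
proof -
  consider "cancellation_congruence = (Id :: 'r rel)"
    | "cancellation_congruence = (UNIV :: 'r rel)"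
    using assms hemiring_congruence_cancellation unfolding congruence_simple_def by blast
  then show ?thesis
  proof cases
    case 1
    then have "x = y" if "x + z = y + z" for x y z :: 'r
      using that unfolding cancellation_congruence_def by blast
    then show ?thesis using congruence_simple_cancellative_ring[OF assms] by blast
  next
    case 2
    then show ?thesis
      using semiregular_if_cancellation_total jacobson_radical_UNIV_if_semiregular by blast
  qed
qed

section \<open>Congruence-simple rings\<close>

text \<open>
  In a ring this is congruence modulo \<open>I\<close>; having a summand on each side makes it symmetric without
  subtraction.
\<close>

definition bourne_relation :: "'r::semiring_0 set \<Rightarrow> 'r rel" where
  "bourne_relation I = {(x, y). \<exists>i\<in>I. \<exists>j\<in>I. x + i = y + j}"

lemma bourne_relation_equivalence:
  fixes I :: "'r::semiring_0 set"
  assumes zero: "0 \<in> I" and add: "\<forall>x\<in>I. \<forall>y\<in>I. x + y \<in> I"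
  shows "(x, x) \<in> bourne_relation I"
    and "(x, y) \<in> bourne_relation I \<Longrightarrow> (y, x) \<in> bourne_relation I"
    and "(x, y) \<in> bourne_relation I \<Longrightarrow> (y, z) \<in> bourne_relation I \<Longrightarrow> (x, z) \<in> bourne_relation I"
    and "(x, y) \<in> bourne_relation I \<Longrightarrow> (x + c, y + c) \<in> bourne_relation I"
proof -
  show "(x, x) \<in> bourne_relation I" using zero by (auto simp: bourne_relation_def)
  show "(x, y) \<in> bourne_relation I \<Longrightarrow> (y, x) \<in> bourne_relation I"
    by (simp add: bourne_relation_def) metis
  show "(x, y) \<in> bourne_relation I \<Longrightarrow> (x + c, y + c) \<in> bourne_relation I"
    by (simp add: bourne_relation_def) (metis add.assoc add.commute)
  assume "(x, y) \<in> bourne_relation I" "(y, z) \<in> bourne_relation I"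
  then obtain i j k l where ij: "i \<in> I" "j \<in> I" "k \<in> I" "l \<in> I" "x + i = y + j" "y + k = z + l"
    by (auto simp: bourne_relation_def)
  then have "x + (i + k) = z + (j + l)"
    by (metis add.assoc add.commute)
  then show "(x, z) \<in> bourne_relation I"
    unfolding bourne_relation_def using add ij by blast
qed

lemma hemiring_congruence_bourne:
  assumes "two_sided_ring_ideal I"
  shows "hemiring_congruence (bourne_relation I)"
proof -
  have I: "0 \<in> I" "\<forall>x\<in>I. \<forall>y\<in>I. x + y \<in> I"
    "\<And>x r. x \<in> I \<Longrightarrow> r * x \<in> I" "\<And>x r. x \<in> I \<Longrightarrow> x * r \<in> I"
    using assms by (auto simp: two_sided_ring_ideal_def)
  show ?thesis
  proof (rule hemiring_congruenceI)
    fix x y c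
    assume "(x, y) \<in> bourne_relation I"
    then obtain i j where ij: "i \<in> I" "j \<in> I" "x + i = y + j" by (auto simp: bourne_relation_def)
    then have "x * c + i * c = y * c + j * c" by (metis distrib_right)
    then show "(x * c, y * c) \<in> bourne_relation I"
      using I ij unfolding bourne_relation_def by blast
    from ij have "c * x + c * i = c * y + c * j" by (metis distrib_left)
    then show "(c * x, c * y) \<in> bourne_relation I"
      using I ij unfolding bourne_relation_def by blast
  qed (fact bourne_relation_equivalence[OF I(1,2)])+
qed

lemma simple_ring_if_congruence_simple:
  assumes neg: "\<forall>a :: 'r::semiring_0. \<exists>b. a + b = 0" and simple: "congruence_simple TYPE('r)"
  shows "simple_ring TYPE('r)"
proof -
  have "I = {0} \<or> I = UNIV" if I: "two_sided_ring_ideal I" for I :: "'r set"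
  proof -
    have I0: "0 \<in> I" and Iadd: "\<And>x y. x \<in> I \<Longrightarrow> y \<in> I \<Longrightarrow> x + y \<in> I"
      and Ineg: "\<And>x y. x \<in> I \<Longrightarrow> x + y = 0 \<Longrightarrow> y \<in> I"
      using I by (auto simp: two_sided_ring_ideal_def)
    have "(x, 0) \<in> bourne_relation I \<longleftrightarrow> x \<in> I" for x
    proof
      assume "(x, 0) \<in> bourne_relation I"
      then obtain i j where ij: "i \<in> I" "j \<in> I" "x + i = j" by (auto simp: bourne_relation_def)
      obtain i' where i': "i + i' = 0" using neg by blast
      then have "x = j + i'" using ij by (metis add.assoc add_0_right)
      then show "x \<in> I" using i' ij Iadd Ineg by blast
    next
      assume "x \<in> I"
      then have "\<exists>i\<in>I. \<exists>j\<in>I. x + i = 0 + j" using I0 by (metis add.commute)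
      then show "(x, 0) \<in> bourne_relation I" by (simp add: bourne_relation_def)
    qed
    moreover have "bourne_relation I = Id \<or> bourne_relation I = UNIV"
      using simple hemiring_congruence_bourne[OF I] unfolding congruence_simple_def by blast
    ultimately show ?thesis by auto
  qed
  then show ?thesis using neg by (simp add: simple_ring_def)
qed

lemma congruence_simple_if_simple_ring:
  assumes "simple_ring TYPE('r::semiring_0)"
  shows "congruence_simple TYPE('r)"
  unfolding congruence_simple_def
proof (intro allI impI)
  fix E :: "'r rel"
  assume E: "hemiring_congruence E"
  note E_rules = hemiring_congruenceD[OF E]
  have neg: "\<exists>b. a + b = 0" for a :: 'r using assms by (simp add: simple_ring_def)
  let ?I = "{x. (x, 0) \<in> E}"
  have "two_sided_ring_ideal ?I"
    unfolding two_sided_ring_ideal_def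
  proof (intro conjI ballI allI impI)
    show "0 \<in> ?I" using E_rules(1) by simp
    fix x assume x: "x \<in> ?I"
    show "x + y \<in> ?I" if "y \<in> ?I" for y
      using E_rules(4)[of x 0 y 0] x that by simp
    show "y \<in> ?I" if "x + y = 0" for y
      using E_rules(2)[OF E_rules(4)[of x 0 y y]] x that E_rules(1) by simp
    show "r * x \<in> ?I" for r using E_rules(5)[of r r x 0] x E_rules(1) by simp
    show "x * r \<in> ?I" for r using E_rules(5)[of x 0 r r] x E_rules(1) by simp
  qed
  then consider "?I = {0}" | "?I = UNIV" using assms unfolding simple_ring_def by blast
  then show "E = Id \<or> E = UNIV"
  proof cases
    case 1
    have "x = y" if "(x, y) \<in> E" for x y
    proof -
      obtain y' where y': "y + y' = 0" using neg by blast
      have "(x + y', y + y') \<in> E" by (rule E_rules(4)[OF that E_rules(1)])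
      then have "x + y' = 0" using 1 y' by auto
      then show "x = y" using y' by (metis add.assoc add.commute add_0)
    qed
    then show ?thesis using E_rules(1) by auto
  next
    case 2
    then have "(x, y) \<in> E" for x y using E_rules(2)[of y 0] E_rules(3)[of x 0 y] by blast
    then show ?thesis by auto
  qed
qed

section \<open>Quotient semimodules\<close>

definition left_congruence :: "'r::semiring_0 rel \<Rightarrow> bool" where
  "left_congruence E \<longleftrightarrow> equiv UNIV E \<and>
     (\<forall>x y c. (x, y) \<in> E \<longrightarrow> (x + c, y + c) \<in> E \<and> (c * x, c * y) \<in> E)"

definition quotient_semimodule :: "'r::semiring_0 rel \<Rightarrow> ('r, 'r set) module" where
  "quotient_semimodule E = \<lparr>carrier = UNIV // E, mult = undefined, one = undefined,
     zero = E `` {0}, add = (\<lambda>X Y. \<Union>x\<in>X. \<Union>y\<in>Y. E `` {x + y}),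
     smult = (\<lambda>r X. \<Union>x\<in>X. E `` {r * x})\<rparr>"

lemma quotient_semimodule_simps:
  assumes E: "left_congruence E"
  shows "carrier (quotient_semimodule E) = range (\<lambda>x. E `` {x})"
    and "\<zero>\<^bsub>quotient_semimodule E\<^esub> = E `` {0}"
    and "E `` {x} \<oplus>\<^bsub>quotient_semimodule E\<^esub> E `` {y} = E `` {x + y}"
    and "r \<odot>\<^bsub>quotient_semimodule E\<^esub> E `` {x} = E `` {r * x}"
    and "E `` {x} = E `` {y} \<longleftrightarrow> (x, y) \<in> E"
proof -
  have eq: "equiv UNIV E" using E by (simp add: left_congruence_def)
  have comp: "(x, y) \<in> E \<Longrightarrow> (x + c, y + c) \<in> E" "(x, y) \<in> E \<Longrightarrow> (c * x, c * y) \<in> E" for x y c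
    using E by (simp_all add: left_congruence_def)
  show "carrier (quotient_semimodule E) = range (\<lambda>x. E `` {x})"
    by (auto simp: quotient_semimodule_def quotient_def)
  show "\<zero>\<^bsub>quotient_semimodule E\<^esub> = E `` {0}" by (simp add: quotient_semimodule_def)
  have "(\<lambda>x y. E `` {x + y}) respects2 E"
    using equiv_class_eq[OF eq] comp(1) by (intro congruent2_commuteI[OF eq]) (auto simp: add.commute)
  then show "E `` {x} \<oplus>\<^bsub>quotient_semimodule E\<^esub> E `` {y} = E `` {x + y}"
    by (simp add: quotient_semimodule_def UN_equiv_class2[OF eq eq])
  have "(\<lambda>x. E `` {r * x}) respects E"
    using equiv_class_eq[OF eq] comp(2) by (intro congruentI) auto
  then show "r \<odot>\<^bsub>quotient_semimodule E\<^esub> E `` {x} = E `` {r * x}"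
    by (simp add: quotient_semimodule_def UN_equiv_class[OF eq])
  show "E `` {x} = E `` {y} \<longleftrightarrow> (x, y) \<in> E"
    using eq_equiv_class_iff[OF eq] by simp
qed

lemma left_semimodule_quotient:
  assumes "left_congruence E"
  shows "left_semimodule (quotient_semimodule E)"
proof -
  note simps = quotient_semimodule_simps(1-4)[OF assms]
  have "abelian_monoid (quotient_semimodule E)"
    by (rule abelian_monoidI) (auto simp: simps ac_simps)
  then show ?thesis
    by (rule left_semimodule.intro, intro left_semimodule_axioms.intro)
      (auto simp: simps mult.assoc distrib_left distrib_right)
qed

section \<open>Irreducible modules over rings that are not semiregular\<close>

text \<open>
  Closure under differences is stated without negation: \<open>y\<close> is the difference of \<open>x + y\<close> and \<open>x\<close>.
\<close>

definition left_ring_ideal :: "'r::semiring_0 set \<Rightarrow> bool" where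
  "left_ring_ideal I \<longleftrightarrow> 0 \<in> I \<and> (\<forall>x\<in>I. \<forall>y\<in>I. x + y \<in> I) \<and>
     (\<forall>x\<in>I. \<forall>y. x + y \<in> I \<longrightarrow> y \<in> I) \<and> (\<forall>x\<in>I. \<forall>r. r * x \<in> I)"

lemma left_ring_idealD:
  assumes "left_ring_ideal I"
  shows "0 \<in> I" "x \<in> I \<Longrightarrow> y \<in> I \<Longrightarrow> x + y \<in> I" "x \<in> I \<Longrightarrow> x + y \<in> I \<Longrightarrow> y \<in> I"
    "x \<in> I \<Longrightarrow> r * x \<in> I"
  using assms unfolding left_ring_ideal_def by metis+

lemma left_congruence_bourne:
  assumes "left_ring_ideal I"
  shows "left_congruence (bourne_relation I)"
proof -
  note I = left_ring_idealD[OF assms]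
  have "\<forall>x\<in>I. \<forall>y\<in>I. x + y \<in> I" using I(2) by blast
  note rules = bourne_relation_equivalence[OF I(1) this]
  have "equiv UNIV (bourne_relation I)"
    by (rule equiv_UNIVI) (fact rules)+
  moreover have "(c * x, c * y) \<in> bourne_relation I" if xy: "(x, y) \<in> bourne_relation I" for x y c
  proof -
    obtain i j where ij: "i \<in> I" "j \<in> I" "x + i = y + j"
      using xy by (auto simp: bourne_relation_def)
    then have "c * x + c * i = c * y + c * j" by (metis distrib_left)
    then show ?thesis using I(4) ij unfolding bourne_relation_def by blast
  qed
  ultimately show ?thesis using rules(4) by (simp add: left_congruence_def)
qed

text \<open>
  Let \<open>a \<circ> b\<close> stand for \<open>a + b + a b\<close>, which is associative with unit \<open>0\<close> because adjoining an
  identity turns it into \<open>(1 + a) (1 + b) - 1\<close>.  Semiregularity of the pair \<open>(x, y)\<close> says that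
  \<open>x - y\<close> has a right inverse for \<open>\<circ>\<close>.  In a monoid in which every element has
  a left inverse, left inverses are two-sided; therefore it does not matter that semiregularity
  concerns right ideals whereas semimodules are left semimodules.
\<close>

lemma semiregular_if_left_quasi_regular:
  assumes neg: "\<forall>a :: 'r::semiring_0. \<exists>b. a + b = 0"
    and left: "\<And>a :: 'r. \<exists>b. b + a + b * a = 0"
  shows "right_semiregular (UNIV :: 'r set)"
  unfolding right_semiregular_def
proof (intro ballI)
  fix x y :: 'r
  let ?circ = "\<lambda>a b :: 'r. a + b + a * b"
  have assoc: "?circ (?circ a b) c = ?circ a (?circ b c)" for a b c
    by (simp add: algebra_simps)
  obtain y' where y': "y + y' = 0" using neg by blast
  obtain b where b: "?circ b (x + y') = 0" using left by blast
  obtain c where c: "?circ c b = 0" using left by blast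
  have "c = ?circ c (?circ b (x + y'))" using b by simp
  also have "\<dots> = ?circ (?circ c b) (x + y')" by (rule assoc[symmetric])
  also have "\<dots> = x + y'" using c by simp
  finally have right: "(x + y') + b + (x + y') * b = 0" using c by simp
  have "y * b + y' * b = 0" using y' by (metis distrib_right mult_zero_left)
  then have "x + b + x * b = (x + b + x * b) + (y + y') + (y * b + y' * b)"
    using y' by simp
  also have "\<dots> = ((x + y') + b + (x + y') * b) + (y + y * b)"
    by (simp add: algebra_simps)
  finally have "x + b + x * b + y * 0 = y + 0 + x * 0 + y * b" using right by simp
  then show "\<exists>j1\<in>UNIV. \<exists>j2\<in>UNIV. x + j1 + x * j1 + y * j2 = y + j2 + x * j2 + y * j1"
    by blast
qed

text \<open>
  Multiplying by \<open>-a\<close> from the right is the identity modulo the left ideal of all \<open>r + r a\<close>.  A larger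
  left ideal containing \<open>a\<close> is therefore everything, so that maximality among those omitting \<open>a\<close>
  amounts to maximality among the proper ones.
\<close>

lemma exists_maximal_modular_left_ideal:
  fixes a :: "'r::semiring_0"
  assumes neg: "\<forall>a :: 'r. \<exists>b. a + b = 0" and a: "\<nexists>b. b + a + b * a = 0"
  obtains I where "left_ring_ideal I" "\<And>r. r + r * a \<in> I" "a \<notin> I"
    "\<And>K. left_ring_ideal K \<Longrightarrow> I \<subseteq> K \<Longrightarrow> K \<noteq> I \<Longrightarrow> K = UNIV"
proof -
  let ?L = "range (\<lambda>r. r + r * a)"
  let ?A = "{I. left_ring_ideal I \<and> ?L \<subseteq> I \<and> a \<notin> I}"
  have "left_ring_ideal ?L"
    unfolding left_ring_ideal_def
  proof (intro conjI ballI allI impI)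
    have "0 = 0 + 0 * a" by simp
    then show "0 \<in> ?L" by blast
    fix x assume "x \<in> ?L"
    then obtain r where r: "x = r + r * a" by blast
    show "x + y \<in> ?L" if "y \<in> ?L" for y
    proof -
      obtain s where "y = s + s * a" using \<open>y \<in> ?L\<close> by blast
      then have "x + y = (r + s) + (r + s) * a" using r by (simp add: algebra_simps)
      then show ?thesis by blast
    qed
    show "y \<in> ?L" if "x + y \<in> ?L" for y
    proof -
      obtain s where s: "x + y = s + s * a" using \<open>x + y \<in> ?L\<close> by blast
      obtain r' where r': "r + r' = 0" using neg by blast
      then have r'a: "r * a + r' * a = 0" by (metis distrib_right mult_zero_left)
      have "y = y + (r + r') + (r * a + r' * a)" using r' r'a by simp
      also have "\<dots> = (x + y) + (r' + r' * a)" using r by (simp add: algebra_simps)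
      also have "\<dots> = (s + r') + (s + r') * a" using s by (simp add: algebra_simps)
      finally show ?thesis by blast
    qed
    show "t * x \<in> ?L" for t
    proof -
      have "t * x = t * r + t * r * a" using r by (simp add: algebra_simps)
      then show ?thesis by blast
    qed
  qed
  moreover have "a \<notin> ?L"
  proof
    assume "a \<in> ?L"
    then obtain r where r: "a = r + r * a" by blast
    obtain b where b: "r + b = 0" using neg by blast
    then have "r * a + b * a = 0" by (metis distrib_right mult_zero_left)
    then have "b + (r + r * a) + b * a = 0"
      using b by (metis add.assoc add.commute add_0)
    then show False using a r by metis
  qed
  ultimately have "?A \<noteq> {}" by blast
  moreover have "\<Union>C \<in> ?A" if C: "C \<noteq> {}" "subset.chain ?A C" for C
  proof -
    have members: "left_ring_ideal I" "?L \<subseteq> I" "a \<notin> I" if "I \<in> C" for I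
      using C(2) that by (auto simp: subset.chain_def)
    have common: "\<exists>I\<in>C. x \<in> I \<and> y \<in> I" if "x \<in> \<Union>C" "y \<in> \<Union>C" for x y
      using C(2) that unfolding subset_chain_def by blast
    have "left_ring_ideal (\<Union>C)"
      unfolding left_ring_ideal_def
    proof (intro conjI ballI allI impI)
      show "0 \<in> \<Union>C" using C(1) members(1) left_ring_idealD(1) by blast
      fix x assume x: "x \<in> \<Union>C"
      show "x + y \<in> \<Union>C" if "y \<in> \<Union>C" for y
        using common[OF x that] members(1) left_ring_idealD(2) by blast
      show "y \<in> \<Union>C" if "x + y \<in> \<Union>C" for y
        using common[OF x that] members(1) left_ring_idealD(3) by blast
      show "r * x \<in> \<Union>C" for r
        using x members(1) left_ring_idealD(4) by blast
    qed
    moreover have "?L \<subseteq> \<Union>C" using C(1) members(2) by blast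
    moreover have "a \<notin> \<Union>C" using members(3) by blast
    ultimately show ?thesis by blast
  qed
  ultimately have "\<exists>I\<in>?A. \<forall>K\<in>?A. I \<subseteq> K \<longrightarrow> K = I"
    by (rule subset_Zorn_nonempty)
  then obtain I where I: "I \<in> ?A" and max: "\<And>K. K \<in> ?A \<Longrightarrow> I \<subseteq> K \<Longrightarrow> K = I"
    by (elim bexE) blast
  have "K = UNIV" if K: "left_ring_ideal K" "I \<subseteq> K" "K \<noteq> I" for K
  proof -
    have "a \<in> K" using max[of K] K I by blast
    have "r \<in> K" for r
    proof (rule left_ring_idealD(3)[OF K(1)])
      show "r * a \<in> K" using left_ring_idealD(4)[OF K(1) \<open>a \<in> K\<close>] .
      have "r + r * a \<in> K" using I K(2) by blast
      then show "r * a + r \<in> K" by (simp add: add.commute)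
    qed
    then show ?thesis by blast
  qed
  with I show ?thesis by (intro that[of I]) auto
qed

text \<open>
  The left ideal \<open>R x + I\<close> contains \<open>I\<close>, so it is \<open>I\<close> or everything.  In the first case \<open>x\<close> belongs
  to the left ideal of all \<open>y\<close> with \<open>R y \<subseteq> I\<close>, which is then everything by maximality; but it
  omits \<open>a\<close>, since \<open>r a \<in> I\<close> for all \<open>r\<close> would put every \<open>r\<close> into \<open>I\<close>.
\<close>

lemma maximal_modular_left_ideal_cyclic:
  fixes a :: "'r::semiring_0"
  assumes neg: "\<forall>a :: 'r. \<exists>b. a + b = 0"
    and I: "left_ring_ideal I" "\<And>r. r + r * a \<in> I" "a \<notin> I"
    and max: "\<And>K. left_ring_ideal K \<Longrightarrow> I \<subseteq> K \<Longrightarrow> K \<noteq> I \<Longrightarrow> K = UNIV"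
    and x: "x \<notin> I"
  shows "\<exists>r. \<exists>i\<in>I. y = r * x + i"
proof -
  note I_rules = left_ring_idealD[OF I(1)]
  let ?K = "{y. \<exists>r. \<exists>i\<in>I. y = r * x + i}"
  have "left_ring_ideal ?K"
    unfolding left_ring_ideal_def
  proof (intro conjI ballI allI impI)
    have "0 = 0 * x + 0" by simp
    then show "0 \<in> ?K" using I_rules(1) by blast
    fix u assume "u \<in> ?K"
    then obtain r i where ri: "i \<in> I" "u = r * x + i" by blast
    show "u + v \<in> ?K" if "v \<in> ?K" for v
    proof -
      obtain s j where sj: "j \<in> I" "v = s * x + j" using \<open>v \<in> ?K\<close> by blast
      then have "u + v = (r + s) * x + (i + j)" using ri by (simp add: algebra_simps)
      then show ?thesis using I_rules(2) ri(1) sj(1) by blast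
    qed
    show "v \<in> ?K" if "u + v \<in> ?K" for v
    proof -
      obtain s j where sj: "j \<in> I" "u + v = s * x + j" using \<open>u + v \<in> ?K\<close> by blast
      obtain r' i' where r': "r + r' = 0" and i': "i + i' = 0" using neg by blast
      have "i' \<in> I" using I_rules(1) I_rules(3)[OF ri(1), of i'] i' by simp
      have r'x: "r * x + r' * x = 0" using r' by (metis distrib_right mult_zero_left)
      have "v = v + (r * x + r' * x) + (i + i')" using r'x i' by simp
      also have "\<dots> = (u + v) + (r' * x + i')" using ri by (simp add: algebra_simps)
      also have "\<dots> = (s + r') * x + (j + i')" using sj by (simp add: algebra_simps)
      finally show ?thesis using I_rules(2) sj(1) \<open>i' \<in> I\<close> by blast
    qed
    show "t * u \<in> ?K" for t
    proof -
      have "t * u = (t * r) * x + t * i" using ri by (simp add: algebra_simps)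
      then show ?thesis using I_rules(4) ri(1) by blast
    qed
  qed
  moreover have "I \<subseteq> ?K"
  proof
    fix i assume "i \<in> I"
    moreover have "i = 0 * x + i" by simp
    ultimately show "i \<in> ?K" by blast
  qed
  moreover have "?K \<noteq> I"
  proof
    assume K: "?K = I"
    have "r * x \<in> ?K" for r
    proof -
      have "r * x = r * x + 0" by simp
      then show ?thesis using I_rules(1) by blast
    qed
    then have Rx: "r * x \<in> I" for r using K by simp
    let ?T = "{y. \<forall>r. r * y \<in> I}"
    have "left_ring_ideal ?T"
      unfolding left_ring_ideal_def
    proof (intro conjI ballI allI impI)
      show "0 \<in> ?T" using I_rules(1) by simp
      fix u assume u: "u \<in> ?T"
      show "u + v \<in> ?T" if "v \<in> ?T" for v
        using u that I_rules(2) by (simp add: distrib_left)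
      show "v \<in> ?T" if uv: "u + v \<in> ?T" for v
      proof (intro CollectI allI)
        fix r
        have "r * u \<in> I" "r * u + r * v \<in> I" using u uv by (simp_all add: distrib_left)
        then show "r * v \<in> I" by (rule I_rules(3))
      qed
      show "s * u \<in> ?T" for s using u by (simp add: mult.assoc[symmetric])
    qed
    moreover have "I \<subseteq> ?T" using I_rules(4) by blast
    moreover have "?T \<noteq> I" using Rx x by blast
    ultimately have "?T = UNIV" by (rule max)
    then have "a \<in> ?T" by simp
    then have "r * a \<in> I" for r by simp
    then have "a \<in> I" using I_rules(3)[of "a * a" a] I(2)[of a] by (simp add: add.commute)
    then show False using I(3) by simp
  qed
  ultimately have "?K = UNIV" by (rule max)
  then show ?thesis by blast
qed

lemma exists_irreducible_semimodule:
  assumes neg: "\<forall>a :: 'r::semiring_0. \<exists>b. a + b = 0"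
    and not_regular: "\<not> right_semiregular (UNIV :: 'r set)"
  shows "\<exists>M :: ('r, 'r set) module. irreducible_semimodule M"
proof -
  obtain a :: 'r where a: "\<nexists>b. b + a + b * a = 0"
    using semiregular_if_left_quasi_regular[OF neg] not_regular by blast
  from exists_maximal_modular_left_ideal[OF neg a] obtain I where
    I: "left_ring_ideal I" "\<And>r. r + r * a \<in> I" "a \<notin> I"
    and max: "\<And>K. left_ring_ideal K \<Longrightarrow> I \<subseteq> K \<Longrightarrow> K \<noteq> I \<Longrightarrow> K = UNIV"
    by blast
  note I_rules = left_ring_idealD[OF I(1)]
  define E where "E = bourne_relation I"
  define M where "M = quotient_semimodule E"
  have E: "left_congruence E" unfolding E_def by (rule left_congruence_bourne[OF I(1)])
  note M = quotient_semimodule_simps[OF E, folded M_def]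
  have cancel: "x = y" if "x + z = y + z" for x y z :: 'r
    using that neg by (metis add.assoc add_0_right)
  have "cancellative M"
    unfolding cancellative_def
  proof (intro ballI impI)
    fix X Y Z
    assume "X \<in> carrier M" "Y \<in> carrier M" "Z \<in> carrier M" and eq: "X \<oplus>\<^bsub>M\<^esub> Z = Y \<oplus>\<^bsub>M\<^esub> Z"
    then obtain x y z where xyz: "X = E `` {x}" "Y = E `` {y}" "Z = E `` {z}"
      unfolding M(1) by blast
    have "(x + z, y + z) \<in> E" using eq xyz M(3,5) by simp
    then obtain i j where ij: "i \<in> I" "j \<in> I" "x + z + i = y + z + j"
      by (auto simp: E_def bourne_relation_def)
    then have "x + i + z = y + j + z" by (simp add: ac_simps)
    then have "x + i = y + j" by (rule cancel)
    then show "X = Y" using ij xyz M(5) by (auto simp: E_def bourne_relation_def)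
  qed
  moreover have "carrier M \<noteq> {\<zero>\<^bsub>M\<^esub>}"
  proof
    assume "carrier M = {\<zero>\<^bsub>M\<^esub>}"
    moreover have "E `` {a} \<in> carrier M" unfolding M(1) by (rule rangeI)
    ultimately have "E `` {a} = E `` {0}" using M(2) by simp
    then have "(a, 0) \<in> E" using M(5) by simp
    then obtain i j where "i \<in> I" "j \<in> I" "a + i = 0 + j"
      by (auto simp: E_def bourne_relation_def)
    then show False using I_rules(3)[of i a] I(3) by (simp add: add.commute)
  qed
  moreover have "\<exists>r1 r2. Y \<oplus>\<^bsub>M\<^esub> r1 \<odot>\<^bsub>M\<^esub> X1 \<oplus>\<^bsub>M\<^esub> r2 \<odot>\<^bsub>M\<^esub> X2 = r1 \<odot>\<^bsub>M\<^esub> X2 \<oplus>\<^bsub>M\<^esub> r2 \<odot>\<^bsub>M\<^esub> X1"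
    if mem: "X1 \<in> carrier M" "X2 \<in> carrier M" "Y \<in> carrier M" and ne: "X1 \<noteq> X2" for X1 X2 Y
  proof -
    obtain x1 x2 y where X: "X1 = E `` {x1}" "X2 = E `` {x2}" "Y = E `` {y}"
      using mem unfolding M(1) by blast
    obtain x2' where x2': "x2 + x2' = 0" using neg by blast
    have "x1 + x2' \<notin> I"
    proof
      assume "x1 + x2' \<in> I"
      moreover have "x1 + 0 = x2 + (x1 + x2')" using x2' by (metis add.left_commute)
      ultimately have "(x1, x2) \<in> E"
        using I_rules(1) unfolding E_def bourne_relation_def by blast
      then show False using ne X M(5) by simp
    qed
    then obtain r i where ri: "i \<in> I" "y = r * (x1 + x2') + i"
      using maximal_modular_left_ideal_cyclic[OF neg I max] by blast
    (* Modulo I, y = r (x1 - x2), so the coefficients 0 and r solve the equation. *)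
    have rx2: "r * x2 + r * x2' = 0" using x2' by (metis distrib_left mult_zero_right)
    have "y + r * x2 + 0 = r * x1 + (r * x2 + r * x2') + i"
      using ri(2) by (simp add: algebra_simps)
    then have "y + r * x2 + 0 = r * x1 + i" using rx2 by simp
    then have "(y + r * x2, r * x1) \<in> E"
      using ri(1) I_rules(1) unfolding E_def bourne_relation_def by blast
    then show ?thesis using X M(3,4,5) by (intro exI[of _ 0] exI[of _ r]) simp
  qed
  ultimately have "irreducible_semimodule M"
    using left_semimodule_quotient[OF E] unfolding irreducible_semimodule_def M_def by blast
  then show ?thesis ..
qed

section \<open>Primitivity\<close>

text \<open>
  The relation of acting equally is a congruence.  If it were total, all of \<open>R\<close> would act as \<open>0\<close>,
  and then the defining equation of irreducibility, applied to a nonzero element and \<open>0\<close>, would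
  force every element to be \<open>0\<close>.
\<close>

lemma congruence_simple_irreducible_faithful:
  fixes M :: "('r::semiring_0, 'm) module"
  assumes simple: "congruence_simple TYPE('r)" and irr: "irreducible_semimodule M"
  shows "faithful M"
proof -
  interpret left_semimodule M using irr by (simp add: irreducible_semimodule_def)
  let ?E = "{(r, s). \<forall>m\<in>carrier M. r \<odot>\<^bsub>M\<^esub> m = s \<odot>\<^bsub>M\<^esub> m}"
  have "hemiring_congruence ?E"
    by (rule hemiring_congruenceI) (auto simp: smult_add_left smult_assoc smult_closed)
  moreover have "?E \<noteq> UNIV"
  proof
    assume E: "?E = UNIV"
    have null: "r \<odot>\<^bsub>M\<^esub> m = \<zero>\<^bsub>M\<^esub>" if "m \<in> carrier M" for r m
    proof -
      have "(r, 0) \<in> ?E" unfolding E by simp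
      then show ?thesis using that smult_zero_left by simp
    qed
    obtain x where x: "x \<in> carrier M" "x \<noteq> \<zero>\<^bsub>M\<^esub>"
      using irr zero_closed unfolding irreducible_semimodule_def by blast
    then obtain r1 r2 where
      "x \<oplus>\<^bsub>M\<^esub> r1 \<odot>\<^bsub>M\<^esub> x \<oplus>\<^bsub>M\<^esub> r2 \<odot>\<^bsub>M\<^esub> \<zero>\<^bsub>M\<^esub> = r1 \<odot>\<^bsub>M\<^esub> \<zero>\<^bsub>M\<^esub> \<oplus>\<^bsub>M\<^esub> r2 \<odot>\<^bsub>M\<^esub> x"
      using irr zero_closed unfolding irreducible_semimodule_def by blast
    then show False using x null by simp
  qed
  ultimately have E: "?E = Id" using simple unfolding congruence_simple_def by blast
  have "r = 0" if "r \<in> annihilator M" for r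
  proof -
    have "(r, 0) \<in> ?E" using that by (simp add: annihilator_def smult_zero_left)
    then show ?thesis unfolding E by simp
  qed
  moreover have "0 \<in> annihilator M" by (simp add: annihilator_def smult_zero_left)
  ultimately show ?thesis unfolding faithful_def by blast
qed

theorem theorem3p10:
  shows "(congruence_simple TYPE('r::semiring_0) \<longrightarrow>
            jacobson_radical = (UNIV :: 'r set) \<or> primitive_hemiring TYPE('r)) \<and>
         (jacobson_radical = ({0} :: 'r set) \<longrightarrow>
            (congruence_simple TYPE('r) \<longleftrightarrow> simple_ring TYPE('r)))"
proof (intro conjI impI iffI)
  assume simple: "congruence_simple TYPE('r)"
  show "jacobson_radical = (UNIV :: 'r set) \<or> primitive_hemiring TYPE('r)"
  proof (cases "jacobson_radical = (UNIV :: 'r set)")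
    case False
    then have "\<forall>a :: 'r. \<exists>b. a + b = 0"
      using congruence_simple_radical_or_ring[OF simple] by blast
    moreover have "\<not> right_semiregular (UNIV :: 'r set)"
      using False jacobson_radical_UNIV_if_semiregular by blast
    ultimately obtain M :: "('r, 'r set) module" where "irreducible_semimodule M"
      using exists_irreducible_semimodule by blast
    then show ?thesis
      using primitive_hemiringI congruence_simple_irreducible_faithful[OF simple] by blast
  qed simp
next
  assume J: "jacobson_radical = ({0} :: 'r set)" and simple: "congruence_simple TYPE('r)"
  (* A radical hemiring with zero radical is the zero ring. *)
  have "\<exists>b. a + b = 0" for a :: 'r
  proof (cases "jacobson_radical = (UNIV :: 'r set)")
    case True
    then have "a = 0" using J by blast
    then show ?thesis by (intro exI[of _ 0]) simp
  next
    case False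
    then show ?thesis using congruence_simple_radical_or_ring[OF simple] by blast
  qed
  then show "simple_ring TYPE('r)" using simple_ring_if_congruence_simple simple by blast
next
  assume "simple_ring TYPE('r)"
  then show "congruence_simple TYPE('r)" by (rule congruence_simple_if_simple_ring)
qed

end
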